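(* There exists $M$ such that for every integer $m \ge M$ and every positive integer $n < m\log_2 m - m\log_2\log_2 m$, some $n$-vertex tournament has no $m$-star-factor.
   Context: A tournament is an orientation of a complete graph. For $m\ge 2$, the $m$-star $S_m$ is the digraph on $m$ vertices consisting of $m-1$ edges with a common tail (the source) and $m-1$ distinct heads. For a tournament $T$ on $n$ vertices, an $m$-star-factor of $T$ is a spanning subgraph of $T$ consisting of $n/m$ pairwise vertex-disjoint copies of $S_m$ (so in particular it requires $n$ to be a multiple of $m$). *)

theory Defs
  imports Complex_Main "Graph_Theory.Graph_Theory"
begin

definition tournament :: "'a pair_pre_digraph \<Rightarrow> bool" where
  "tournament T \<longleftrightarrow>
     pair_digraph T \<and>
     (\<forall>u \<in> pverts T. \<forall>v \<in> pverts T. u \<noteq> v \<longrightarrow> ((u, v) \<in> parcs T) \<noteq> ((v, u) \<in> parcs T))"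

definition out_star :: "nat \<Rightarrow> 'a pair_pre_digraph \<Rightarrow> bool" where
  "out_star m S \<longleftrightarrow>
     finite (pverts S) \<and> card (pverts S) = m \<and>
     (\<exists>c \<in> pverts S. parcs S = {c} \<times> (pverts S - {c}))"

(* The number of stars is n/m; the product form below also makes m divide n. *)
definition star_factor :: "nat \<Rightarrow> 'a pair_pre_digraph \<Rightarrow> 'a pair_pre_digraph \<Rightarrow> bool" where
  "star_factor m T F \<longleftrightarrow>
     spanning (with_proj F) (with_proj T) \<and>
     (\<exists>\<S>. finite \<S> \<and> m * card \<S> = card (pverts T) \<and>
        (\<forall>S \<in> \<S>. out_star m S) \<and>
        pairwise (\<lambda>S S'. pverts S \<inter> pverts S' = {}) \<S> \<and>
        pverts F = (\<Union>S \<in> \<S>. pverts S) \<and>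
        parcs F = (\<Union>S \<in> \<S>. parcs S))"

end

theory Submission
  imports Defs "HOL-Real_Asymp.Real_Asymp"
begin

text \<open>If \<open>m\<close> does not divide \<open>n\<close>, any tournament works. Otherwise let \<open>n = m k\<close>. The centres of the
stars of a factor form a set of \<open>k\<close> vertices that dominates all other vertices. In a uniformly
random tournament a fixed \<open>k\<close>-set is dominating with probability
\<open>(1 - 2^{-k})^{n-k} \<le> exp (- k (m - 1) / 2^k)\<close>, and there are at most \<open>n^k\<close> such sets. The
bound on \<open>n\<close> says \<open>2^k < m / log\<^sub>2 m\<close>, so by the union bound the expected number of dominating
\<open>k\<close>-sets is at most \<open>(m log\<^sub>2 m \<cdot> m^{-(1 - 1/m) / ln 2})^k < 1\<close>. The random argument is carried out
by counting.\<close>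

section \<open>Independence of conditions on disjoint blocks, in counting form\<close>

text \<open>Conditions on disjoint blocks of coordinates are independent: a uniformly random subset
  of \<open>I\<close> misses the one forbidden trace on each \<open>k\<close>-element block with
  probability (1 - 2^(-k))^|W|. Multiplying out the denominators keeps the identity in the
  naturals.\<close>

lemma card_avoiding_traces:
  fixes B Q :: "'v \<Rightarrow> 'i set"
  assumes "finite W" "finite I"
    and "\<And>v. v \<in> W \<Longrightarrow> B v \<subseteq> I" "\<And>v. v \<in> W \<Longrightarrow> Q v \<subseteq> B v" "\<And>v. v \<in> W \<Longrightarrow> card (B v) = k"
    and "disjoint_family_on B W"
  shows "card {A. A \<subseteq> I \<and> (\<forall>v\<in>W. A \<inter> B v \<noteq> Q v)} * 2 ^ (k * card W)
    = 2 ^ card I * (2 ^ k - 1) ^ card W"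
  using assms
proof (induction W arbitrary: I rule: finite_induct)
  case empty
  then show ?case by (simp add: card_Pow flip: Pow_def)
next
  case (insert w W)
  define J where "J = I - B w"
  let ?G = "\<lambda>I W. {A. A \<subseteq> I \<and> (\<forall>v\<in>W. A \<inter> B v \<noteq> Q v)}"
  have Bw: "B w \<subseteq> I" "finite (B w)" "card (B w) = k" "Q w \<subseteq> B w"
    using insert.prems finite_subset[of "B w" I] by auto
  have disj: "B w \<inter> B v = {}" if "v \<in> W" for v
    using insert.prems(5) insert.hyps that by (force simp: disjoint_family_on_def)
  have IH: "card (?G J W) * 2 ^ (k * card W) = 2 ^ card J * (2 ^ k - 1) ^ card W"
  proof (rule insert.IH)
    show "B v \<subseteq> J" if "v \<in> W" for v
      using insert.prems(2)[of v] disj[OF that] that by (auto simp: J_def)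
    show "disjoint_family_on B W"
      using insert.prems(5) by (auto simp: disjoint_family_on_def)
  qed (use insert.prems in \<open>auto simp: J_def\<close>)
  \<comment> \<open>\<open>A\<close> splits into its part outside \<open>B w\<close> and its trace
    on \<open>B w\<close>, chosen independently. The trace can be any of the 2^k subsets except
    \<open>Q w\<close>, and by disjointness it does not affect the other blocks.\<close>
  have "bij_betw (\<lambda>(X, Y). X \<union> Y) (?G J W \<times> (Pow (B w) - {Q w})) (?G I (insert w W))"
  proof (rule bij_betw_byWitness[where f' = "\<lambda>A. (A - B w, A \<inter> B w)"])
    show "\<forall>a\<in>?G J W \<times> (Pow (B w) - {Q w}).
        (\<lambda>A. (A - B w, A \<inter> B w)) ((\<lambda>(X, Y). X \<union> Y) a) = a"
      by (auto simp: J_def)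
    show "\<forall>a'\<in>?G I (insert w W). (\<lambda>(X, Y). X \<union> Y) ((\<lambda>A. (A - B w, A \<inter> B w)) a') = a'"
      by auto
    show "(\<lambda>(X, Y). X \<union> Y) ` (?G J W \<times> (Pow (B w) - {Q w})) \<subseteq> ?G I (insert w W)"
    proof (rule image_subsetI, unfold split_paired_all prod.case)
      fix X Y assume "(X, Y) \<in> ?G J W \<times> (Pow (B w) - {Q w})"
      then have XY: "X \<subseteq> J" "\<forall>v\<in>W. X \<inter> B v \<noteq> Q v" "Y \<subseteq> B w" "Y \<noteq> Q w"
        by auto
      have "(X \<union> Y) \<inter> B w = Y" using XY by (auto simp: J_def)
      moreover have "(X \<union> Y) \<inter> B v = X \<inter> B v" if "v \<in> W" for v
        using XY disj[OF that] by auto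
      moreover have "X \<union> Y \<subseteq> I" using XY Bw by (auto simp: J_def)
      ultimately show "X \<union> Y \<in> ?G I (insert w W)"
        using XY by simp
    qed
    show "(\<lambda>A. (A - B w, A \<inter> B w)) ` ?G I (insert w W) \<subseteq> ?G J W \<times> (Pow (B w) - {Q w})"
    proof (rule image_subsetI)
      fix A assume A: "A \<in> ?G I (insert w W)"
      have "(A - B w) \<inter> B v = A \<inter> B v" if "v \<in> W" for v
        using disj[OF that] by auto
      then show "(A - B w, A \<inter> B w) \<in> ?G J W \<times> (Pow (B w) - {Q w})"
        using A by (auto simp: J_def)
    qed
  qed
  then have "card (?G I (insert w W)) = card (?G J W) * (2 ^ k - 1)"
    using Bw by (auto dest!: bij_betw_same_card simp: card_cartesian_product card_Pow)
  moreover have "card I = card J + k"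
    using Bw insert.prems(1) card_mono[of I "B w"] by (simp add: J_def card_Diff_subset)
  ultimately show ?case
    using IH insert.hyps by (simp add: power_add algebra_simps)
qed

section \<open>Tournaments coded by sets of pairs, and dominating sets\<close>

definition up_pairs :: "nat \<Rightarrow> (nat \<times> nat) set" where
  "up_pairs n = {(i, j). i < j \<and> j < n}"

text \<open>Pairs in \<open>A\<close> point from the smaller to the larger endpoint, the remaining
  ones back. Subsets of \<open>up_pairs n\<close> thus form the sample space, and intersecting with
  \<open>up_pairs n\<close> yields a tournament for every \<open>A\<close>.\<close>

definition orientation :: "nat \<Rightarrow> (nat \<times> nat) set \<Rightarrow> nat pair_pre_digraph" where
  "orientation n A =
     \<lparr>pverts = {..<n}, parcs = (A \<inter> up_pairs n) \<union> (up_pairs n - A)\<inverse>\<rparr>"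

definition dominating :: "'a pair_pre_digraph \<Rightarrow> 'a set \<Rightarrow> bool" where
  "dominating T C \<longleftrightarrow> C \<subseteq> pverts T \<and> (\<forall>v\<in>pverts T - C. \<exists>c\<in>C. (c, v) \<in> parcs T)"

lemma finite_up_pairs: "finite (up_pairs n)"
  by (rule finite_subset[of _ "{..<n} \<times> {..<n}"]) (auto simp: up_pairs_def)

lemma tournament_orientation: "tournament (orientation n A)"
proof -
  have "finite (parcs (orientation n A))"
    by (simp add: orientation_def finite_up_pairs)
  then have "pair_digraph (orientation n A)"
    by unfold_locales (auto simp: orientation_def up_pairs_def)
  then show ?thesis
    by (auto simp: tournament_def orientation_def up_pairs_def)
qed

lemma star_factor_imp_dominating:
  assumes "star_factor m T F"
  obtains C where "dominating T C" "m * card C = card (pverts T)"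
proof -
  have span: "spanning (with_proj F) (with_proj T)"
    using assms by (simp add: star_factor_def)
  obtain \<S> where S: "finite \<S>" "m * card \<S> = card (pverts T)" "\<forall>S\<in>\<S>. out_star m S"
      "pairwise (\<lambda>S S'. pverts S \<inter> pverts S' = {}) \<S>"
      "pverts F = (\<Union>S\<in>\<S>. pverts S)" "parcs F = (\<Union>S\<in>\<S>. parcs S)"
    using assms unfolding star_factor_def by (elim conjE exE)
  have V: "pverts F = pverts T" and E: "parcs F \<subseteq> parcs T"
    using span by (auto simp: spanning_def subgraph_def)
  from S(3) have "\<forall>S\<in>\<S>. \<exists>c\<in>pverts S. parcs S = {c} \<times> (pverts S - {c})"
    by (auto simp: out_star_def)
  then obtain c where c: "\<And>S. S \<in> \<S> \<Longrightarrow> c S \<in> pverts S"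
      "\<And>S. S \<in> \<S> \<Longrightarrow> parcs S = {c S} \<times> (pverts S - {c S})"
    by metis
  \<comment> \<open>Distinct stars with a common centre would share a vertex.\<close>
  have "inj_on c \<S>"
    using S(4) c(1) by (fastforce simp: inj_on_def pairwise_def)
  then have "card (c ` \<S>) = card \<S>" by (rule card_image)
  moreover have "dominating T (c ` \<S>)"
    unfolding dominating_def
  proof (intro conjI ballI)
    show "c ` \<S> \<subseteq> pverts T" using c(1) S(5) V by auto
    fix v assume v: "v \<in> pverts T - c ` \<S>"
    then obtain S where "S \<in> \<S>" "v \<in> pverts S" using S(5) V by auto
    then have "(c S, v) \<in> parcs F" using v c(2) S(6) by auto
    then show "\<exists>c\<in>c ` \<S>. (c, v) \<in> parcs T" using E \<open>S \<in> \<S>\<close> by auto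
  qed
  ultimately show ?thesis using that S(2) by simp
qed

section \<open>Union bound over the candidate dominating sets\<close>

text \<open>A vertex \<open>v\<close> outside \<open>C\<close> is undominated iff all
  \<open>k\<close> edges between \<open>v\<close> and \<open>C\<close> leave \<open>v\<close>, which
  is a single forbidden trace of \<open>A\<close> on those edges.\<close>

lemma card_dominated_orientations:
  assumes "C \<subseteq> {..<n}" "card C = k"
  shows "card {A. A \<subseteq> up_pairs n \<and> dominating (orientation n A) C} * 2 ^ (k * (n - k))
    \<le> 2 ^ card (up_pairs n) * (2 ^ k - 1) ^ (n - k)"
proof -
  define W where "W = {..<n} - C"
  \<comment> \<open>\<open>B v\<close> codes the edges between \<open>v\<close> and
    \<open>C\<close>. All of them leave \<open>v\<close> when exactly those with \<open>v\<close> as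
    the smaller endpoint lie in \<open>A\<close>; this trace is \<open>Q v\<close>.\<close>
  define B where "B v = (\<lambda>c. (min c v, max c v)) ` C" for v
  define Q where "Q v = {v} \<times> {c\<in>C. v < c}" for v
  let ?G = "{A. A \<subseteq> up_pairs n \<and> (\<forall>v\<in>W. A \<inter> B v \<noteq> Q v)}"
  have "finite C" using assms(1) finite_subset by blast
  then have cW: "card W = n - k" using assms by (simp add: W_def card_Diff_subset)
  have "card ?G * 2 ^ (k * card W) = 2 ^ card (up_pairs n) * (2 ^ k - 1) ^ card W"
  proof (rule card_avoiding_traces)
    show "B v \<subseteq> up_pairs n" if "v \<in> W" for v
    proof
      fix p assume "p \<in> B v"
      then obtain c where c: "p = (min c v, max c v)" "c \<in> C" by (auto simp: B_def)
      then have "c < n" "v < n" "c \<noteq> v" using that assms(1) by (auto simp: W_def)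
      then show "p \<in> up_pairs n" using c(1) by (auto simp: up_pairs_def)
    qed
    show "Q v \<subseteq> B v" if "v \<in> W" for v
    proof
      fix p assume "p \<in> Q v"
      then obtain c where "p = (v, c)" "c \<in> C" "v < c" by (auto simp: Q_def)
      then have "p = (min c v, max c v)" by simp
      then show "p \<in> B v" using \<open>c \<in> C\<close> by (auto simp: B_def)
    qed
    show "card (B v) = k" if "v \<in> W" for v
      using assms(2) that unfolding B_def
      by (subst card_image) (auto simp: inj_on_def min_def max_def split: if_splits)
    \<comment> \<open>A pair in \<open>B v\<close> determines \<open>v\<close> as its only endpoint
      outside \<open>C\<close>.\<close>
    show "disjoint_family_on B W"
      by (auto simp: disjoint_family_on_def B_def W_def min_def max_def split: if_splits)
  qed (auto simp: W_def finite_up_pairs)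
  moreover have "{A. A \<subseteq> up_pairs n \<and> dominating (orientation n A) C} \<subseteq> ?G"
  proof clarify
    fix A v assume A: "A \<subseteq> up_pairs n" "dominating (orientation n A) C" and v: "v \<in> W"
      and eq: "A \<inter> B v = Q v"
    from A(2) v obtain c where c: "c \<in> C" "(c, v) \<in> parcs (orientation n A)"
      by (auto simp: dominating_def orientation_def W_def)
    have cB: "(min c v, max c v) \<in> B v" using c(1) by (simp add: B_def)
    from c(2) consider "(c, v) \<in> A" "c < v" | "(v, c) \<notin> A" "v < c"
      by (auto simp: orientation_def up_pairs_def)
    then show False
    proof cases
      case 1
      then have "(c, v) \<in> Q v" using cB eq by auto
      then show False using 1 by (auto simp: Q_def)
    next
      case 2
      then have "(v, c) \<in> Q v" using c(1) by (auto simp: Q_def)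
      then show False using 2 eq by auto
    qed
  qed
  then have "card {A. A \<subseteq> up_pairs n \<and> dominating (orientation n A) C} \<le> card ?G"
    by (intro card_mono) (auto simp: finite_up_pairs)
  then have "card {A. A \<subseteq> up_pairs n \<and> dominating (orientation n A) C} * 2 ^ (k * card W)
      \<le> card ?G * 2 ^ (k * card W)"
    by (rule mult_le_mono1)
  ultimately show ?thesis unfolding cW by (simp only:)
qed

lemma tournament_without_dominating_set:
  fixes n k :: nat
  assumes "real (n choose k) * (1 - 1 / 2 ^ k) ^ (n - k) < 1"
  obtains T :: "nat pair_pre_digraph"
  where "tournament T" "pverts T = {..<n}" "\<And>C. dominating T C \<Longrightarrow> card C \<noteq> k"
proof -
  let ?P = "up_pairs n"
  define \<C> where "\<C> = {C. C \<subseteq> {..<n} \<and> card C = k}"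
  let ?bad = "\<lambda>C. {A. A \<subseteq> ?P \<and> dominating (orientation n A) C}"
  have fin: "finite \<C>" by (simp add: \<C>_def)
  have card_bad: "real (card (?bad C)) \<le> 2 ^ card ?P * (1 - 1 / 2 ^ k) ^ (n - k)"
    if "C \<in> \<C>" for C
  proof -
    have "card (?bad C) * 2 ^ (k * (n - k)) \<le> 2 ^ card ?P * (2 ^ k - 1) ^ (n - k)"
      using that by (intro card_dominated_orientations) (auto simp: \<C>_def)
    then have "real (card (?bad C) * 2 ^ (k * (n - k))) \<le> real (2 ^ card ?P * (2 ^ k - 1) ^ (n - k))"
      using of_nat_le_iff by blast
    then have "real (card (?bad C)) * 2 ^ (k * (n - k)) \<le> 2 ^ card ?P * (2 ^ k - 1) ^ (n - k)"
      by (simp add: of_nat_diff)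
    then have "real (card (?bad C)) \<le> 2 ^ card ?P * ((2 ^ k - 1) ^ (n - k) / (2 ^ k) ^ (n - k))"
      by (simp add: field_simps power_mult)
    also have "(2 ^ k - 1) ^ (n - k) / (2 ^ k) ^ (n - k) = (1 - 1 / 2 ^ k :: real) ^ (n - k)"
      by (simp add: diff_divide_distrib flip: power_divide)
    finally show ?thesis .
  qed
  have "real (card (\<Union>C\<in>\<C>. ?bad C)) \<le> (\<Sum>C\<in>\<C>. real (card (?bad C)))"
    using card_UN_le[OF fin, of ?bad] by (simp flip: of_nat_sum)
  also have "\<dots> \<le> card \<C> * (2 ^ card ?P * (1 - 1 / 2 ^ k) ^ (n - k))"
    using card_bad by (rule sum_bounded_above)
  also have "\<dots> = 2 ^ card ?P * (real (n choose k) * (1 - 1 / 2 ^ k) ^ (n - k))"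
    by (simp add: \<C>_def n_subsets)
  also have "\<dots> < 2 ^ card ?P * 1"
    using assms by (intro mult_strict_left_mono) auto
  also have "\<dots> = real (card (Pow ?P))"
    by (simp add: card_Pow finite_up_pairs)
  \<comment> \<open>The bad orientations number fewer than all orientations, so some
    \<open>A\<close> is bad for no \<open>C\<close>.\<close>
  finally have "(\<Union>C\<in>\<C>. ?bad C) \<noteq> Pow ?P" by auto
  then obtain A where A: "A \<subseteq> ?P" "\<And>C. C \<in> \<C> \<Longrightarrow> \<not> dominating (orientation n A) C"
    by auto
  show ?thesis
  proof
    show "tournament (orientation n A)" by (rule tournament_orientation)
    show "pverts (orientation n A) = {..<n}" by (simp add: orientation_def)
    show "card C \<noteq> k" if "dominating (orientation n A) C" for C
      using A(2)[of C] that by (auto simp: \<C>_def dominating_def orientation_def)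
  qed
qed

section \<open>Numerical estimates\<close>

text \<open>Since 1 / ln 2 > 1, exp (- log 2 m) = m^(-1-d) with d > 0. This cancels the factor m and
  leaves m^(-d), which beats the logarithm.\<close>

lemma eventually_union_bound:
  "\<forall>\<^sub>F m::nat in sequentially. real m > 1 \<and> log 2 (real m) > 1 \<and>
     real m * log 2 (real m) * exp (- (log 2 (real m) * (real m - 1) / real m)) < 1"
proof -
  define d where "d = 1 / ln 2 - (1 :: real)"
  have d: "d > 0" using ln_2_less_1 by (simp add: d_def field_simps)
  have log: "log 2 x = (1 + d) * ln x" for x :: real
    by (simp add: log_def d_def)
  have "\<forall>\<^sub>F m::nat in sequentially. real m > 1" by real_asymp
  moreover have "\<forall>\<^sub>F m::nat in sequentially. (1 + d) * ln (real m) > 1"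
    using d by real_asymp
  moreover have "\<forall>\<^sub>F m::nat in sequentially.
      (1 + d) * ln (real m) * real m powr (- d) * exp (1 + d) < 1"
    using d by real_asymp
  \<comment> \<open>This bounds the cost of having m - 1 instead of m in the exponent by the
    constant factor exp (1 + d).\<close>
  moreover have "\<forall>\<^sub>F m::nat in sequentially. ln (real m) / real m \<le> 1" by real_asymp
  ultimately show ?thesis unfolding log
  proof eventually_elim
    case (elim m)
    let ?l = "ln (real m)"
    have "- ((1 + d) * ?l * (real m - 1) / real m) = (- d) * ?l + (1 + d) * (?l / real m) - ?l"
      using elim(1) by (simp add: field_simps)
    also have "exp \<dots> = exp ((- d) * ?l) * exp ((1 + d) * (?l / real m)) / exp ?l"
      by (simp only: exp_diff exp_add)
    also have "\<dots> = real m powr (- d) * exp ((1 + d) * (?l / real m)) / real m"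
      using elim(1) by (simp add: powr_def)
    finally have "exp (- ((1 + d) * ?l * (real m - 1) / real m))
        = real m powr (- d) * exp ((1 + d) * (?l / real m)) / real m" .
    then have "real m * ((1 + d) * ?l) * exp (- ((1 + d) * ?l * (real m - 1) / real m))
        = (1 + d) * ?l * real m powr (- d) * exp ((1 + d) * (?l / real m))"
      using elim(1) by simp
    also have "\<dots> \<le> (1 + d) * ?l * real m powr (- d) * exp (1 + d)"
      using elim(1,4) d mult_left_mono[OF elim(4), of "1 + d"] by (intro mult_left_mono) auto
    finally show ?case using elim by simp
  qed
qed

lemma union_bound_less_one:
  fixes m k :: nat
  defines "L \<equiv> log 2 (real m)"
  assumes m: "real m > 1" "L > 1" "real m * L * exp (- (L * (real m - 1) / real m)) < 1"
    and k: "k > 0" "real k < L - log 2 L"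
  shows "real (m * k choose k) * (1 - 1 / 2 ^ k) ^ (m * k - k) < 1"
proof -
  have "2 powr real k < 2 powr (L - log 2 L)"
    using k(2) by simp
  also have "\<dots> = real m / L"
    using m by (simp add: powr_diff L_def)
  finally have "2 ^ k < real m / L" by (simp add: powr_realpow)
  then have inv: "L / real m \<le> 1 / 2 ^ k"
    using m by (simp add: field_simps)
  \<comment> \<open>As \<open>L\<close> > 1, the term \<open>log 2 L\<close> is positive. The bound
    lets \<open>L\<close> replace the factor \<open>k\<close> in (m k)^k below.\<close>
  have kL: "real k < L" using k(2) m(2) by (smt (verit) zero_less_log_cancel_iff)
  have e: "m * k - k = (m - 1) * k" by (simp add: diff_mult_distrib)
  have "(1 - 1 / 2 ^ k :: real) \<le> exp (- (1 / 2 ^ k))"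
    using exp_ge_add_one_self[of "- (1 / 2 ^ k) :: real"] by simp
  also have "\<dots> \<le> exp (- (L / real m))" using inv by simp
  finally have "(1 - 1 / 2 ^ k :: real) ^ (m - 1) \<le> exp (- (L / real m)) ^ (m - 1)"
    by (intro power_mono) auto
  also have "\<dots> = exp (- (L * (real m - 1) / real m))"
    using m(1) by (simp add: of_nat_diff flip: exp_of_nat_mult)
  finally have q: "(1 - 1 / 2 ^ k :: real) ^ (m - 1) \<le> exp (- (L * (real m - 1) / real m))" .
  have "real (m * k choose k) \<le> real ((m * k) ^ k)"
    using binomial_le_pow[of k "m * k"] m(1) by (intro of_nat_mono) simp
  then have "real (m * k choose k) * (1 - 1 / 2 ^ k) ^ (m * k - k)
      \<le> real (m * k) ^ k * ((1 - 1 / 2 ^ k) ^ (m - 1)) ^ k"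
    by (simp add: e power_mult mult_right_mono)
  \<comment> \<open>Everything is now a \<open>k\<close>-th power, so it suffices that the base is
    below 1; strictness then uses \<open>k\<close> > 0.\<close>
  also have "\<dots> = (real m * real k * (1 - 1 / 2 ^ k) ^ (m - 1)) ^ k"
    by (simp add: power_mult_distrib)
  also have "\<dots> \<le> (real m * L * exp (- (L * (real m - 1) / real m))) ^ k"
    using q kL m by (intro power_mono mult_mono) auto
  also have "\<dots> < 1"
    using m k(1) by (intro power_less_one_iff[THEN iffD2]) auto
  finally show ?thesis .
qed

theorem theorem1:
  shows "\<exists>M::nat. \<forall>m::nat. \<forall>n::nat.
    m \<ge> M \<and> 0 < n \<and>
    real n < real m * log 2 (real m) - real m * log 2 (log 2 (real m)) \<longrightarrow>
    (\<exists>T :: nat pair_pre_digraph.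
       tournament T \<and> card (pverts T) = n \<and> \<not> (\<exists>F. star_factor m T F))"
proof -
  obtain M where M: "\<And>m. m \<ge> M \<Longrightarrow> real m > 1 \<and> log 2 (real m) > 1 \<and>
      real m * log 2 (real m) * exp (- (log 2 (real m) * (real m - 1) / real m)) < 1"
    using eventually_union_bound unfolding eventually_sequentially by blast
  have "\<exists>T :: nat pair_pre_digraph.
      tournament T \<and> card (pverts T) = n \<and> \<not> (\<exists>F. star_factor m T F)"
    if mn: "m \<ge> M" "0 < n"
      "real n < real m * log 2 (real m) - real m * log 2 (log 2 (real m))" for m n :: nat
  proof (cases "m dvd n")
    case False
    then show ?thesis
      using tournament_orientation[of n "{}"]
      \<comment> \<open>The count \<open>m * card \<S> = card (pverts T)\<close> in
        \<open>star_factor\<close> already forces \<open>m\<close> to divide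
        \<open>n\<close>.\<close>
      by (intro exI[of _ "orientation n {}"]) (auto simp: star_factor_def orientation_def dvd_def)
  next
    case True
    then obtain k where k: "n = m * k" by (auto simp: dvd_def)
    then have "real m * real k < real m * (log 2 (real m) - log 2 (log 2 (real m)))"
      using mn(3) by (simp add: algebra_simps)
    then have "real k < log 2 (real m) - log 2 (log 2 (real m))"
      using M[OF mn(1)] by simp
    then have "real (n choose k) * (1 - 1 / 2 ^ k) ^ (n - k) < 1"
      unfolding k using M[OF mn(1)] mn(2) k by (intro union_bound_less_one) auto
    then obtain T :: "nat pair_pre_digraph" where
      T: "tournament T" "pverts T = {..<n}" "\<And>C. dominating T C \<Longrightarrow> card C \<noteq> k"
      using tournament_without_dominating_set by blast
    have "\<not> star_factor m T F" for F
    proof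
      assume "star_factor m T F"
      then obtain C where "dominating T C" "m * card C = card (pverts T)"
        by (rule star_factor_imp_dominating)
      \<comment> \<open>Positivity of \<open>n\<close> gives \<open>m\<close> > 0, so cancelling
        \<open>m\<close> in m * card C = m * k yields \<open>card C = k\<close>.\<close>
      then show False using T(2,3) k mn(2) by auto
    qed
    then show ?thesis using T(1,2) by auto
  qed
  then show ?thesis by blast
qed

end
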